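(* Let the initial-value problem $y'(t)=\Phi(t,y(t))$, $y(0)=v$, $t\in[0,T]$, with solution $y(t)$, be given, where for every $k=0,1,2,\dots$ one has the splitting $\Phi(t,y)=-A_k y+f_k(y)+g(t)$ for all $y\in\mathbb{R}^N$, $t\ge 0$. Assume that the mappings $f_k$ are all Lipschitz continuous with a common Lipschitz constant $L$, and that there exist constants $C>0$ and $\omega\ge 0$ such that the matrices $A_k$ satisfy a common exponential bound, i.e. for all $k$ $$\|f_k(u)-f_k(w)\|\le L\|u-w\|\quad \forall u,w\in\mathbb{R}^N,\qquad \|\exp(-tA_k)\|\le Ce^{-\omega t}\quad\forall t\ge 0.$$ Let the problem be solved iteratively by nonlinear waveform relaxation: $y_0(t)$, $t\in[0,T]$, is an initial approximation to $y(t)$ with $y_0(0)=v$, and for $k=0,1,2,\dots$ the function $y_{k+1}$ is the solution of the linear initial-value problem $$y_{k+1}'(t)=-A_k y_{k+1}(t)+f_k(y_k(t))+g(t),\quad y_{k+1}(0)=v,\quad t\in[0,T].$$ Let $T>0$ be chosen such that, for a certain constant $\delta\in(0,1)$, the following sufficient condition for convergence of the iteration holds: $$C L T\varphi_1(-\omega T)\le\delta<1.$$ For $k=1,2,\dots$ let $\epsilon_k(t)=y(t)-y_k(t)$ be the error and $$r_k(t)=-A_{k-1}y_k(t)+f_{k-1}(y_k(t))+g(t)-y_k'(t),\quad t\in[0,T],$$ the residual of $y_k$. Then, for all $t\in[0,T]$, $$\max_{s\in[0,t]}\|\epsilon_k(s)\|\le\frac{C t\varphi_1(-\omega t)}{1-C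 L t\varphi_1(-\omega t)}\max_{s\in[0,t]}\|r_k(s)\|\le\frac{\delta}{(1-\delta)L}\max_{s\in[0,t]}\|r_k(s)\|.$$ (Note that $T\varphi_1(-\omega T)$ increases with $T$ monotonically.)
   Context: $\Phi:\mathbb{R}\times\mathbb{R}^N\to\mathbb{R}^N$ and $v\in\mathbb{R}^N$ are given; $A_k\in\mathbb{R}^{N\times N}$; $f_k:\mathbb{R}^N\to\mathbb{R}^N$; $g:\mathbb{R}\to\mathbb{R}^N$. $\|\cdot\|$ is a vector norm in $\mathbb{C}^N$ or the corresponding induced matrix norm. The entire function $\varphi_1$ is given by $\varphi_1(z)=(e^z-1)/z$ for $z\ne 0$ and $\varphi_1(0)=1$. *)

theory Defs
  imports "HOL-Analysis.Analysis"
begin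

definition vector_norm :: "(complex ^ 'n \<Rightarrow> real) \<Rightarrow> bool" where
  "vector_norm \<nu> \<longleftrightarrow>
     (\<forall>x. 0 \<le> \<nu> x) \<and>
     (\<forall>x. \<nu> x = 0 \<longleftrightarrow> x = 0) \<and>
     (\<forall>c x. \<nu> (c *s x) = cmod c * \<nu> x) \<and>
     (\<forall>x y. \<nu> (x + y) \<le> \<nu> x + \<nu> y)"

definition induced_norm :: "(complex ^ 'n \<Rightarrow> real) \<Rightarrow> complex ^ 'n ^ 'n \<Rightarrow> real" where
  "induced_norm \<nu> M = (SUP x\<in>{x. x \<noteq> 0}. \<nu> (M *v x) / \<nu> x)"

definition cvec :: "real ^ 'n \<Rightarrow> complex ^ 'n" where
  "cvec x = (\<chi> i. complex_of_real (x $ i))"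

text \<open>The norm is a norm on the complex space; it is applied to real vectors through
  \<^const>\<open>cvec\<close> and to real matrices through
  \<^const>\<open>map_matrix\<close> \<^const>\<open>complex_of_real\<close>.  In particular the induced norm of
  a real matrix is a supremum over complex vectors.\<close>

text \<open>The type of square matrices is not an instance of the algebra classes required by
  \<^const>\<open>exp\<close>, hence the explicit power series.\<close>

primrec mat_pow :: "real ^ 'n ^ 'n \<Rightarrow> nat \<Rightarrow> real ^ 'n ^ 'n" where
  "mat_pow M 0 = mat 1"
| "mat_pow M (Suc j) = M ** mat_pow M j"

definition mat_exp :: "real ^ 'n ^ 'n \<Rightarrow> real ^ 'n ^ 'n" where
  "mat_exp M = (\<Sum>j. (1 / fact j) *\<^sub>R mat_pow M j)"

definition phi1 :: "'a \<Rightarrow> 'a::{real_normed_field,banach}" where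
  "phi1 z = (if z = 0 then 1 else (exp z - 1) / z)"

text \<open>Classical solution on \<open>[0,T]\<close>, with one-sided derivatives at the endpoints.\<close>

definition solves_ivp ::
  "real \<Rightarrow> (real \<Rightarrow> real ^ 'n \<Rightarrow> real ^ 'n) \<Rightarrow> real ^ 'n \<Rightarrow> (real \<Rightarrow> real ^ 'n) \<Rightarrow> bool" where
  "solves_ivp T F v y \<longleftrightarrow>
     y 0 = v \<and>
     (\<forall>t\<in>{0..T}. (y has_vector_derivative F t (y t)) (at t within {0..T}))"

definition wr_residual ::
  "(nat \<Rightarrow> real ^ 'n ^ 'n) \<Rightarrow> (nat \<Rightarrow> real ^ 'n \<Rightarrow> real ^ 'n) \<Rightarrow> (real \<Rightarrow> real ^ 'n) \<Rightarrow>
     real \<Rightarrow> (nat \<Rightarrow> real \<Rightarrow> real ^ 'n) \<Rightarrow> nat \<Rightarrow> real \<Rightarrow> real ^ 'n" where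
  "wr_residual A f g T Y k t =
     - (A (k - 1) *v Y k t) + f (k - 1) (Y k t) + g t
       - vector_derivative (Y k) (at t within {0..T})"

text \<open>A genuine maximum: the value is meaningful only if it is attained on \<open>S\<close>.\<close>

definition max_on :: "'a set \<Rightarrow> ('a \<Rightarrow> real) \<Rightarrow> real" where
  "max_on S h = (GREATEST m. m \<in> h ` S)"

end

(* The error e of an iterate solves e' = - A e + h with e(0) = 0, where h is the difference of the
   nonlinear terms plus the residual. Variation of constants represents e(t) as the integral of
   exp (- (t - s) A) h(s). Since exp (- omega (t - s)) integrates to t phi1 (- omega t), the exponential
   bound gives max |e| <= C t phi1 (- omega t) (L max |e| + max |r|), which is solved for max |e|. *)

theory Submission
  imports Defs
begin

section \<open>Seminorms on Euclidean spaces\<close>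

locale euclidean_seminorm =
  fixes q :: "'a::euclidean_space \<Rightarrow> real"
  assumes scaleR: "q (c *\<^sub>R x) = \<bar>c\<bar> * q x"
    and triangle: "q (x + y) \<le> q x + q y"
begin

lemma zero [simp]: "q 0 = 0"
  using scaleR[of 0 0] by simp

lemma minus [simp]: "q (- x) = q x"
  using scaleR[of "-1" x] by simp

lemma nonneg: "0 \<le> q x"
  using triangle[of x "- x"] by simp

lemma sum_le: "q (\<Sum>i\<in>S. h i) \<le> (\<Sum>i\<in>S. q (h i))"
proof (induction S rule: infinite_finite_induct)
  case (insert i S)
  then show ?case using triangle[of "h i" "\<Sum>i\<in>S. h i"] by simp
qed auto

text \<open>Expansion in \<open>Basis\<close> bounds \<open>q x\<close> by coordinates, each at most
  \<open>norm x\<close> in absolute value. The summand 1 in \<open>?K\<close> keeps the constant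
  strictly positive.\<close>

lemma le_norm: obtains K where "0 < K" "\<And>x. q x \<le> K * norm x"
proof
  let ?K = "1 + (\<Sum>b\<in>Basis. q b)"
  have pos: "0 \<le> (\<Sum>b\<in>Basis. q b)" by (intro sum_nonneg nonneg)
  then show "0 < ?K" by simp
  fix x :: 'a
  have "q x = q (\<Sum>b\<in>Basis. (x \<bullet> b) *\<^sub>R b)" by (simp add: euclidean_representation)
  also have "\<dots> \<le> (\<Sum>b\<in>Basis. \<bar>x \<bullet> b\<bar> * q b)"
    using sum_le[of "\<lambda>b. (x \<bullet> b) *\<^sub>R b" Basis] by (simp add: scaleR)
  also have "\<dots> \<le> (\<Sum>b\<in>Basis. norm x * q b)"
    by (intro sum_mono mult_right_mono nonneg Basis_le_norm)
  also have "\<dots> \<le> ?K * norm x"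
    by (simp add: sum_distrib_left[symmetric] algebra_simps)
  finally show "q x \<le> ?K * norm x" .
qed

lemma abs_diff_le: "\<bar>q x - q y\<bar> \<le> q (x - y)"
  using triangle[of "x - y" y] triangle[of "y - x" x] minus[of "x - y"] by simp

lemma continuous: "continuous_on S q"
proof -
  obtain K where K: "0 < K" "\<And>x. q x \<le> K * norm x" using le_norm by blast
  have "K-lipschitz_on S q"
    using K order_trans[OF abs_diff_le K(2)]
    by (intro lipschitz_onI) (auto simp: dist_norm)
  then show ?thesis by (rule lipschitz_on_continuous_on)
qed

text \<open>A definite \<open>q\<close> is positive and continuous on the compact unit sphere. Its
  minimum there serves as the constant, and homogeneity extends the bound to all vectors.\<close>

lemma norm_le:
  assumes "\<And>x. q x = 0 \<Longrightarrow> x = 0"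
  obtains c where "0 < c" "\<And>x. c * norm x \<le> q x"
proof -
  have "compact (sphere (0::'a) 1)" "sphere (0::'a) 1 \<noteq> {}" by simp_all
  then obtain z where z: "norm z = 1" "\<And>x. norm x = 1 \<Longrightarrow> q z \<le> q x"
    using continuous_attains_inf[OF _ _ continuous, of "sphere 0 1"] by auto
  have "q z \<noteq> 0" using assms[of z] z(1) by auto
  then have "0 < q z" using nonneg[of z] by linarith
  moreover have "q z * norm x \<le> q x" for x
  proof (cases "x = 0")
    case False
    then have "q z \<le> q (inverse (norm x) *\<^sub>R x)" by (intro z) simp
    then show ?thesis using False by (simp add: scaleR field_simps)
  qed simp
  ultimately show thesis by (rule that)
qed

text \<open>The triangle inequality gives the bound for Riemann sums, and \<open>le_norm\<close>
  turns their Euclidean convergence into convergence in \<open>q\<close>. Working with the sums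
  keeps the constant 1, with no loss from norm equivalence.\<close>

lemma has_integral_le:
  assumes f: "(f has_integral I) {a..b::real}"
    and h: "(h has_integral J) {a..b}"
    and le: "\<And>x. x \<in> {a..b} \<Longrightarrow> q (f x) \<le> h x"
  shows "q I \<le> J"
proof -
  obtain K where K: "0 < K" "\<And>x. q x \<le> K * norm x" using le_norm by blast
  have "q I \<le> J + e" if "0 < e" for e
  proof -
    \<comment> \<open>The two approximation errors are \<open>d\<close> for the sum of
      \<open>h\<close> and \<open>K * d\<close> for the sum of \<open>f\<close>; together they make
      \<open>e\<close>.\<close>
    define d where "d = e / (1 + K)"
    have "d * (1 + K) = e" using K(1) by (simp add: d_def)
    then have d: "0 < d" "d + K * d = e" using that K(1) by (simp add: d_def, simp add: algebra_simps)
    obtain \<gamma> where \<gamma>: "gauge \<gamma>" "\<And>D. D tagged_division_of {a..b} \<Longrightarrow> \<gamma> fine D \<Longrightarrow>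
        norm ((\<Sum>(x, k)\<in>D. measure lborel k *\<^sub>R f x) - I) < d"
      using f[unfolded has_integral_real, rule_format, OF d(1)] by auto
    obtain \<gamma>' where \<gamma>': "gauge \<gamma>'" "\<And>D. D tagged_division_of {a..b} \<Longrightarrow> \<gamma>' fine D \<Longrightarrow>
        norm ((\<Sum>(x, k)\<in>D. measure lborel k *\<^sub>R h x) - J) < d"
      using h[unfolded has_integral_real, rule_format, OF d(1)] by auto
    \<comment> \<open>A single division fine for both gauges allows the two sums to be compared term
      by term.\<close>
    obtain D where D: "D tagged_division_of {a..b}" "(\<lambda>x. \<gamma> x \<inter> \<gamma>' x) fine D"
      using fine_division_exists_real[OF gauge_Int[OF \<gamma>(1) \<gamma>'(1)]] by blast
    let ?R = "\<Sum>(x, k)\<in>D. measure lborel k *\<^sub>R f x" and ?S = "\<Sum>(x, k)\<in>D. measure lborel k *\<^sub>R h x"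
    have fine: "\<gamma> fine D" "\<gamma>' fine D" using D(2) by (auto simp: fine_Int)
    have "q ?R \<le> (\<Sum>z\<in>D. q (case z of (x, k) \<Rightarrow> measure lborel k *\<^sub>R f x))" by (rule sum_le)
    also have "\<dots> \<le> ?S"
      using tag_in_interval[OF D(1)[folded box_real]]
      by (intro sum_mono) (auto simp: scaleR intro!: mult_left_mono le)
    also have "\<dots> \<le> J + d" using \<gamma>'(2)[OF D(1) fine(2)] by auto
    finally have R: "q ?R \<le> J + d" .
    have "q (I - ?R) \<le> K * norm (I - ?R)" by (rule K)
    also have "\<dots> \<le> K * d"
      using \<gamma>(2)[OF D(1) fine(1)] K(1) by (intro mult_left_mono) (auto simp: norm_minus_commute)
    finally show ?thesis using R triangle[of "I - ?R" ?R] d(2) by simp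
  qed
  then show ?thesis by (rule field_le_epsilon)
qed

end

section \<open>The vector norm and its induced matrix norm\<close>

lemma vector_norm_seminorm:
  fixes \<nu> :: "complex ^ 'n \<Rightarrow> real"
  assumes "vector_norm \<nu>"
  shows "euclidean_seminorm \<nu>"
proof
  fix c :: real and x y :: "complex ^ 'n"
  have "c *\<^sub>R x = complex_of_real c *s x" by (simp add: vec_eq_iff) (simp add: scaleR_conv_of_real)
  then show "\<nu> (c *\<^sub>R x) = \<bar>c\<bar> * \<nu> x" using assms by (simp add: vector_norm_def)
  show "\<nu> (x + y) \<le> \<nu> x + \<nu> y" using assms by (simp add: vector_norm_def)
qed

text \<open>The pull-back of \<open>\<nu>\<close> along the real-linear embedding
  \<open>cvec\<close> is the seminorm in which real solutions are measured.\<close>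

lemma vector_norm_cvec_seminorm:
  fixes \<nu> :: "complex ^ 'n \<Rightarrow> real"
  assumes "vector_norm \<nu>"
  shows "euclidean_seminorm (\<lambda>x. \<nu> (cvec x))"
proof -
  interpret euclidean_seminorm \<nu> using assms by (rule vector_norm_seminorm)
  have "cvec (c *\<^sub>R x) = c *\<^sub>R cvec x" "cvec (x + y) = cvec x + cvec y" for c and x y :: "real ^ 'n"
    by (simp_all add: cvec_def vec_eq_iff) (simp add: scaleR_conv_of_real)
  then show ?thesis by unfold_locales (simp_all add: scaleR triangle)
qed

text \<open>The supremum in \<open>induced_norm\<close> dominates its quotients only once they are
  known to be bounded above. Equivalence of \<open>\<nu>\<close> with the Euclidean norm and the
  Euclidean operator norm of \<open>M\<close> supply such a bound.\<close>

lemma vector_norm_matrix_le: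
  fixes \<nu> :: "complex ^ 'n \<Rightarrow> real"
  assumes "vector_norm \<nu>"
  shows "\<nu> (M *v x) \<le> induced_norm \<nu> M * \<nu> x"
proof (cases "x = 0")
  case True
  interpret euclidean_seminorm \<nu> using assms by (rule vector_norm_seminorm)
  show ?thesis using True by simp
next
  case False
  interpret euclidean_seminorm \<nu> using assms by (rule vector_norm_seminorm)
  have zero_iff: "\<nu> z = 0 \<longleftrightarrow> z = 0" for z using assms by (simp add: vector_norm_def)
  obtain K where K: "0 < K" "\<And>x. \<nu> x \<le> K * norm x" using le_norm by blast
  obtain c where c: "0 < c" "\<And>x. c * norm x \<le> \<nu> x" using norm_le zero_iff by metis
  have pos: "0 < \<nu> z" if "z \<noteq> 0" for z using zero_iff[of z] nonneg[of z] that by linarith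
  let ?B = "onorm ((*v) M)"
  have "\<nu> (M *v z) / \<nu> z \<le> K * ?B / c" if "z \<noteq> 0" for z
  proof -
    have "\<nu> (M *v z) \<le> K * (?B * norm z)"
      using order_trans[OF K(2) mult_left_mono[OF onorm[of "(*v) M"]]] K(1) by simp
    also have "\<dots> = K * ?B / c * (c * norm z)" using c(1) by simp
    also have "\<dots> \<le> K * ?B / c * \<nu> z"
      using c K(1) by (intro mult_left_mono) (auto intro!: divide_nonneg_pos mult_nonneg_nonneg onorm_pos_le)
    finally show ?thesis using pos[OF that] by (simp add: pos_divide_le_eq)
  qed
  then have "bdd_above ((\<lambda>z. \<nu> (M *v z) / \<nu> z) ` {z. z \<noteq> 0})" by (auto intro!: bdd_aboveI)
  then have "\<nu> (M *v x) / \<nu> x \<le> induced_norm \<nu> M"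
    unfolding induced_norm_def using False by (intro cSUP_upper) simp_all
  then show ?thesis using pos[OF False] by (simp add: pos_divide_le_eq)
qed

lemma cvec_matrix_vector_mult:
  "cvec (M *v x) = map_matrix complex_of_real M *v cvec x"
  by (simp add: cvec_def matrix_vector_mult_def vec_eq_iff)

section \<open>The matrix exponential and its derivative\<close>

lemma mat_pow_scaleR: "mat_pow (t *\<^sub>R M) n = t ^ n *\<^sub>R mat_pow M n"
  by (induction n) (simp_all add: matrix_matrix_mult_def vec_eq_iff sum_distrib_left mult_ac)

text \<open>The recursion multiplies on the left, whereas the derivative of the exponential is
  computed with the factor \<open>M\<close> on the right.\<close>

lemma mat_pow_Suc_right: "mat_pow M (Suc n) = mat_pow M n ** M"
proof (induction n)
  case (Suc n)
  show ?case by (subst mat_pow.simps(2), subst Suc) (simp add: matrix_mul_assoc)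
qed simp

lemma norm_mat_pow_mult_le:
  "norm (mat_pow M n *v x) \<le> onorm ((*v) M) ^ n * norm x"
proof (induction n)
  case (Suc n)
  have "norm (M *v (mat_pow M n *v x)) \<le> onorm ((*v) M) * norm (mat_pow M n *v x)"
    by (intro onorm) simp
  also have "\<dots> \<le> onorm ((*v) M) * (onorm ((*v) M) ^ n * norm x)"
    by (intro mult_left_mono Suc onorm_pos_le) simp
  finally show ?case by (simp add: matrix_vector_mul_assoc mult.assoc)
qed simp

text \<open>The entry is a coordinate of the image of a unit vector. The resulting geometric bound
  makes each entry of the exponential a scalar power series in \<open>t\<close> that converges
  everywhere.\<close>

lemma abs_mat_pow_entry_le: "\<bar>mat_pow M n $ i $ j\<bar> \<le> onorm ((*v) M) ^ n"
proof -
  have "mat_pow M n $ i $ j = (mat_pow M n *v axis j 1) $ i"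
    by (simp add: matrix_vector_mult_basis column_def)
  also have "\<bar>\<dots>\<bar> \<le> norm (mat_pow M n *v axis j 1)" by (rule component_le_norm_cart)
  also have "\<dots> \<le> onorm ((*v) M) ^ n" using norm_mat_pow_mult_le[of M n "axis j 1"] by simp
  finally show ?thesis .
qed

lemma summable_mat_exp_entry: "summable (\<lambda>n. mat_pow M n $ i $ j / fact n * t ^ n)"
proof (rule summable_comparison_test)
  have "norm (mat_pow M n $ i $ j / fact n * t ^ n)
      \<le> inverse (fact n) * (onorm ((*v) M) * \<bar>t\<bar>) ^ n" for n
    using mult_right_mono[OF abs_mat_pow_entry_le, of "\<bar>t\<bar> ^ n / fact n" M n i j]
    by (simp add: abs_mult power_abs power_mult_distrib field_simps)
  then show "\<exists>N. \<forall>n\<ge>N. norm (mat_pow M n $ i $ j / fact n * t ^ n)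
      \<le> inverse (fact n) * (onorm ((*v) M) * \<bar>t\<bar>) ^ n" by blast
  show "summable (\<lambda>n. inverse (fact n) * (onorm ((*v) M) * \<bar>t\<bar>) ^ n)" by (rule summable_exp)
qed

lemma mat_exp_entry:
  "mat_exp (t *\<^sub>R M) $ i $ j = (\<Sum>n. mat_pow M n $ i $ j / fact n * t ^ n)"
proof -
  have "(\<lambda>n. (1 / fact n) *\<^sub>R mat_pow (t *\<^sub>R M) n) sums
      (\<chi> i j. \<Sum>n. mat_pow M n $ i $ j / fact n * t ^ n)"
    using summable_LIMSEQ[OF summable_mat_exp_entry[of M _ _ t]] unfolding sums_def
    by (intro vec_tendstoI) (simp add: mat_pow_scaleR mult_ac)
  then show ?thesis unfolding mat_exp_def by (simp add: sums_unique[symmetric])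
qed

lemma mat_exp_0: "mat_exp (0 :: real ^ 'n ^ 'n) = mat 1"
proof -
  \<comment> \<open>Zero is written as a multiple so that \<open>mat_exp_entry\<close> applies; at
    \<open>t = 0\<close> only the constant coefficient survives.\<close>
  have "mat_exp (0 *\<^sub>R (0 :: real ^ 'n ^ 'n)) $ i $ j = mat 1 $ i $ j" for i j
    unfolding mat_exp_entry
    using powser_zero[of "\<lambda>n. mat_pow (0 :: real ^ 'n ^ 'n) n $ i $ j / fact n"] by simp
  then show ?thesis by (simp add: vec_eq_iff)
qed

lemma has_vector_derivative_vecI:
  assumes "\<And>i. ((\<lambda>t. F t $ i) has_vector_derivative F' $ i) net"
  shows "(F has_vector_derivative F') net"
  using assms unfolding has_vector_derivative_def has_derivative_def
  by (auto intro!: vec_tendstoI bounded_linear_intros)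

text \<open>Each entry is differentiated termwise. Passing to \<open>diffs\<close> turns the
  coefficient into an entry of \<open>mat_pow M (Suc n)\<close> over \<open>fact n\<close>, from
  which one factor \<open>M\<close> splits off.\<close>

lemma has_vector_derivative_mat_exp:
  "((\<lambda>t. mat_exp (t *\<^sub>R M)) has_vector_derivative mat_exp (t *\<^sub>R M) ** M) (at t)"
proof (intro has_vector_derivative_vecI)
  fix i j
  let ?c = "\<lambda>n. mat_pow M n $ i $ j / fact n"
  have "diffs ?c n * t ^ n = (\<Sum>k\<in>UNIV. (mat_pow M n $ i $ k / fact n * t ^ n) * M $ k $ j)" for n
    unfolding diffs_def mat_pow_Suc_right
    by (simp add: matrix_matrix_mult_def sum_distrib_left sum_divide_distrib field_simps del: of_nat_Suc)
  then have "(\<lambda>n. diffs ?c n * t ^ n) sums (\<Sum>k\<in>UNIV. mat_exp (t *\<^sub>R M) $ i $ k * M $ k $ j)"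
    unfolding mat_exp_entry
    by (simp only:) (intro sums_sum sums_mult2 summable_sums summable_mat_exp_entry)
  then have "(\<Sum>n. diffs ?c n * t ^ n) = (mat_exp (t *\<^sub>R M) ** M) $ i $ j"
    by (simp add: matrix_matrix_mult_def sums_unique[symmetric])
  then show "((\<lambda>t. mat_exp (t *\<^sub>R M) $ i $ j) has_vector_derivative (mat_exp (t *\<^sub>R M) ** M) $ i $ j) (at t)"
    using termdiffs_strong_converges_everywhere[of ?c t, OF summable_mat_exp_entry]
    by (simp add: mat_exp_entry has_real_derivative_iff_has_vector_derivative)
qed

section \<open>Variation of constants\<close>

lemma bounded_bilinear_matrix_vector_mult:
  "bounded_bilinear ((*v) :: real ^ 'n ^ 'm \<Rightarrow> real ^ 'n \<Rightarrow> real ^ 'm)"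
  unfolding bilinear_conv_bounded_bilinear[symmetric] bilinear_def
  by (auto intro!: linearI simp: matrix_vector_mult_def vec_eq_iff sum.distrib sum_distrib_left
      algebra_simps)

text \<open>With the exponential as integrating factor, the terms containing \<open>A *v e s\<close>
  cancel in the derivative of \<open>?E s *v e s\<close>. The fundamental theorem of calculus then
  leaves \<open>e t\<close> at the upper end and 0 at the lower.\<close>

lemma variation_of_constants:
  assumes t: "0 \<le> t"
    and e: "\<And>s. s \<in> {0..t} \<Longrightarrow>
      (e has_vector_derivative - (A *v e s) + h s) (at s within {0..t})"
    and e0: "e 0 = 0"
  shows "((\<lambda>s. mat_exp (- ((t - s) *\<^sub>R A)) *v h s) has_integral e t) {0..t}"
proof -
  let ?E = "\<lambda>s. mat_exp ((t - s) *\<^sub>R (- A))"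
  have "((\<lambda>s. ?E s *v e s) has_vector_derivative ?E s *v h s) (at s within {0..t})"
    if s: "s \<in> {0..t}" for s
  proof -
    have "((\<lambda>s. t - s) has_vector_derivative -1) (at s within {0..t})"
      by (auto intro!: derivative_eq_intros)
    from vector_diff_chain_within[OF this has_vector_derivative_at_within[OF has_vector_derivative_mat_exp]]
    have E: "(?E has_vector_derivative - (?E s ** - A)) (at s within {0..t})"
      unfolding o_def by (simp del: scaleR_minus_right)
    from bounded_bilinear.has_vector_derivative[OF bounded_bilinear_matrix_vector_mult E e[OF s]]
    have "((\<lambda>s. ?E s *v e s) has_vector_derivative
        ?E s *v (- (A *v e s) + h s) + - (?E s ** - A) *v e s) (at s within {0..t})" .
    moreover have "- (?E s ** - A) *v e s = ?E s *v (A *v e s)"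
      by (simp add: matrix_vector_mul_assoc)
        (simp add: matrix_matrix_mult_def vec_eq_iff matrix_vector_mult_def sum_negf)
    ultimately show ?thesis by (simp add: matrix_vector_mult_diff_distrib)
  qed
  from fundamental_theorem_of_calculus[OF t this] show ?thesis
    by (simp add: e0 mat_exp_0)
qed

section \<open>The function \<open>\<tau> * phi1 (- \<omega> * \<tau>)\<close>\<close>

lemma has_real_derivative_times_phi1:
  "((\<lambda>\<tau>. \<tau> * phi1 (- \<omega> * \<tau>)) has_real_derivative exp (- \<omega> * \<tau>)) (at \<tau>)" for \<omega> \<tau> :: real
proof (cases "\<omega> = 0")
  case True
  then show ?thesis by (simp add: phi1_def)
next
  case False
  \<comment> \<open>The factor \<open>\<tau>\<close> absorbs the removable singularity, so one
    closed form also covers \<open>\<tau> = 0\<close>.\<close>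
  then have "(\<lambda>\<tau>. \<tau> * phi1 (- \<omega> * \<tau>)) = (\<lambda>\<tau>. (1 - exp (- \<omega> * \<tau>)) / \<omega>)"
    by (auto simp: phi1_def fun_eq_iff field_simps)
  with False show ?thesis by (auto intro!: derivative_eq_intros)
qed

lemma strict_mono_times_phi1: "strict_mono (\<lambda>\<tau>. \<tau> * phi1 (- \<omega> * \<tau>))" for \<omega> :: real
proof (rule strict_monoI)
  fix a b :: real assume "a < b"
  then show "a * phi1 (- \<omega> * a) < b * phi1 (- \<omega> * b)"
    by (rule DERIV_pos_imp_increasing) (use has_real_derivative_times_phi1 in force)
qed

text \<open>Reflecting \<open>s\<close> to \<open>t - s\<close> gives an antiderivative that
  vanishes at \<open>s = t\<close>, so the integral comes from the endpoint 0.\<close>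

lemma has_integral_exp_times_phi1:
  fixes t \<omega> :: real
  assumes "0 \<le> t"
  shows "((\<lambda>s. exp (- \<omega> * (t - s))) has_integral t * phi1 (- \<omega> * t)) {0..t}"
proof -
  have "((\<lambda>s. - ((t - s) * phi1 (- \<omega> * (t - s)))) has_vector_derivative exp (- \<omega> * (t - s)))
      (at s within {0..t})" for s
  proof -
    have "((\<lambda>s. t - s) has_real_derivative -1) (at s)" by (auto intro!: derivative_eq_intros)
    from DERIV_minus[OF DERIV_chain2[OF has_real_derivative_times_phi1 this]] show ?thesis
      by (simp add: has_real_derivative_iff_has_vector_derivative has_vector_derivative_at_within)
  qed
  from fundamental_theorem_of_calculus[OF assms this] show ?thesis by simp
qed

section \<open>Maxima and the bound for the linear problem\<close>

lemma max_on_attains: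
  fixes h :: "'a::topological_space \<Rightarrow> real"
  assumes "compact S" "S \<noteq> {}" "continuous_on S h"
  obtains s where "s \<in> S" "max_on S h = h s"
    and "\<And>x. x \<in> S \<Longrightarrow> h x \<le> max_on S h"
proof -
  obtain s where s: "s \<in> S" "\<And>x. x \<in> S \<Longrightarrow> h x \<le> h s"
    using continuous_attains_sup[OF assms] by blast
  \<comment> \<open>\<open>GREATEST\<close> is determined because the supremum is attained.\<close>
  then have "max_on S h = h s"
    unfolding max_on_def by (intro Greatest_equality) auto
  with s show thesis by (intro that) auto
qed

text \<open>The norm is taken under the integral in the variation-of-constants formula; the
  exponential bound dominates the kernel by a scalar function with known integral.\<close>

lemma linear_ivp_bound:
  fixes \<nu> :: "complex ^ 'n \<Rightarrow> real" and A :: "real ^ 'n ^ 'n"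
  assumes norm: "vector_norm \<nu>"
    and exp_bound: "\<And>s. 0 \<le> s \<Longrightarrow>
      induced_norm \<nu> (map_matrix complex_of_real (mat_exp (- (s *\<^sub>R A)))) \<le> C * exp (- \<omega> * s)"
    and t: "0 \<le> t"
    and e: "\<And>s. s \<in> {0..t} \<Longrightarrow>
      (e has_vector_derivative - (A *v e s) + h s) (at s within {0..t})"
    and e0: "e 0 = 0"
    and C: "0 \<le> C"
    and h: "\<And>s. s \<in> {0..t} \<Longrightarrow> \<nu> (cvec (h s)) \<le> D"
  shows "\<nu> (cvec (e t)) \<le> C * (t * phi1 (- \<omega> * t)) * D"
proof -
  interpret euclidean_seminorm "\<lambda>x. \<nu> (cvec x)" using norm by (rule vector_norm_cvec_seminorm)
  have int: "((\<lambda>s. C * exp (- \<omega> * (t - s)) * D) has_integral C * (t * phi1 (- \<omega> * t)) * D) {0..t}"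
    by (intro has_integral_mult_left has_integral_mult_right has_integral_exp_times_phi1 t)
  show ?thesis
  proof (rule has_integral_le[OF _ int])
    show "((\<lambda>s. mat_exp (- ((t - s) *\<^sub>R A)) *v h s) has_integral e t) {0..t}"
      using t e e0 by (rule variation_of_constants)
    fix s assume s: "s \<in> {0..t}"
    let ?E = "mat_exp (- ((t - s) *\<^sub>R A))"
    have "\<nu> (cvec (?E *v h s)) \<le> induced_norm \<nu> (map_matrix complex_of_real ?E) * \<nu> (cvec (h s))"
      unfolding cvec_matrix_vector_mult by (rule vector_norm_matrix_le[OF norm])
    also have "\<dots> \<le> C * exp (- \<omega> * (t - s)) * \<nu> (cvec (h s))"
      using s by (intro mult_right_mono nonneg exp_bound) auto
    also have "\<dots> \<le> C * exp (- \<omega> * (t - s)) * D"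
      using h[OF s] C by (intro mult_left_mono) auto
    finally show "\<nu> (cvec (?E *v h s)) \<le> C * exp (- \<omega> * (t - s)) * D" .
  qed
qed

section \<open>The error estimate for the iteration\<close>

theorem proposition3:
  fixes \<nu> :: "complex ^ 'n \<Rightarrow> real"
    and \<Phi> :: "real \<Rightarrow> real ^ 'n \<Rightarrow> real ^ 'n"
    and v :: "real ^ 'n"
    and A :: "nat \<Rightarrow> real ^ 'n ^ 'n"
    and f :: "nat \<Rightarrow> real ^ 'n \<Rightarrow> real ^ 'n"
    and g :: "real \<Rightarrow> real ^ 'n"
    and y :: "real \<Rightarrow> real ^ 'n"
    and Y :: "nat \<Rightarrow> real \<Rightarrow> real ^ 'n"
    and C L \<omega> \<delta> T :: real
  assumes norm: "vector_norm \<nu>"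
    and T_pos: "0 < T"
    and splitting: "\<And>k t x. 0 \<le> t \<Longrightarrow> \<Phi> t x = - (A k *v x) + f k x + g t"
    and solution: "solves_ivp T \<Phi> v y"
    and C_pos: "0 < C" and omega_nonneg: "0 \<le> \<omega>"
    and lipschitz: "\<And>k u w. \<nu> (cvec (f k u - f k w)) \<le> L * \<nu> (cvec (u - w))"
    and exp_bound: "\<And>k t. 0 \<le> t \<Longrightarrow>
          induced_norm \<nu> (map_matrix complex_of_real (mat_exp (- (t *\<^sub>R A k)))) \<le> C * exp (- \<omega> * t)"
    and initial: "continuous_on {0..T} (Y 0)" "Y 0 0 = v"
    and iteration: "\<And>k. solves_ivp T (\<lambda>t x. - (A k *v x) + f k (Y k t) + g t) v (Y (Suc k))"
    and delta: "0 < \<delta>" "\<delta> < 1"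
    and convergence: "C * L * T * phi1 (- \<omega> * T) \<le> \<delta>"
  shows "(\<forall>k\<ge>1. \<forall>t\<in>{0..T}.
            max_on {0..t} (\<lambda>s. \<nu> (cvec (y s - Y k s)))
              \<le> C * t * phi1 (- \<omega> * t) / (1 - C * L * t * phi1 (- \<omega> * t))
                  * max_on {0..t} (\<lambda>s. \<nu> (cvec (wr_residual A f g T Y k s)))
          \<and> (L \<noteq> 0 \<longrightarrow>
              C * t * phi1 (- \<omega> * t) / (1 - C * L * t * phi1 (- \<omega> * t))
                  * max_on {0..t} (\<lambda>s. \<nu> (cvec (wr_residual A f g T Y k s)))
              \<le> \<delta> / ((1 - \<delta>) * L)
                  * max_on {0..t} (\<lambda>s. \<nu> (cvec (wr_residual A f g T Y k s)))))
       \<and> strict_mono_on {0..} (\<lambda>\<tau>. \<tau> * phi1 (- \<omega> * \<tau>))"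
proof (intro conjI allI impI ballI)
  interpret real_norm: euclidean_seminorm "\<lambda>x. \<nu> (cvec x)"
    using norm by (rule vector_norm_cvec_seminorm)
  let ?q = "\<lambda>x. \<nu> (cvec x)" and ?P = "\<lambda>\<tau>. \<tau> * phi1 (- \<omega> * \<tau>)"
  have P_mono: "?P a \<le> ?P b" if "a \<le> b" for a b
    by (rule monoD[OF strict_mono_mono[OF strict_mono_times_phi1] that])
  have P_nonneg: "0 \<le> ?P a" if "0 \<le> a" for a using P_mono[OF that] by simp
  have L: "0 \<le> L"
  \<comment> \<open>The sign of \<open>L\<close> follows by testing the Lipschitz condition on the
    nonzero vector \<open>?u\<close> and 0.\<close>
  proof -
    let ?u = "1 :: real ^ 'n"
    have "cvec ?u \<noteq> 0" by (simp add: cvec_def vec_eq_iff)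
    then have "0 < ?q ?u" using norm real_norm.nonneg[of ?u] by (auto simp: vector_norm_def less_le)
    moreover have "0 \<le> L * ?q ?u"
      using order_trans[OF real_norm.nonneg lipschitz[of 0 ?u 0]] by simp
    ultimately show ?thesis by (simp add: zero_le_mult_iff)
  qed
  show "strict_mono_on {0..} ?P"
    using strict_mono_times_phi1 by (auto intro: monotone_on_subset)

  fix k :: nat and t :: real
  assume k: "1 \<le> k" and t: "t \<in> {0..T}"
  \<comment> \<open>The residual of iterate \<open>k\<close> refers to the splitting with index
    \<open>k - 1\<close>, so the exact solution is also written with the splitting
    \<open>m\<close>.\<close>
  then obtain m where m: "k = Suc m" by (cases k) auto
  let ?e = "\<lambda>s. y s - Y k s" and ?r = "wr_residual A f g T Y k"
  let ?h = "\<lambda>s. f m (y s) - f m (Y k s) + ?r s"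
  define a where "a = C * ?P t"
  define E where "E = max_on {0..t} (\<lambda>s. ?q (?e s))"
  define R where "R = max_on {0..t} (\<lambda>s. ?q (?r s))"

  have y': "(y has_vector_derivative - (A m *v y s) + f m (y s) + g s) (at s within {0..T})"
    if "s \<in> {0..T}" for s
  proof -
    have "(y has_vector_derivative \<Phi> s (y s)) (at s within {0..T})"
      using solution that by (simp add: solves_ivp_def)
    then show ?thesis using that splitting[where t = s and k = m] by simp
  qed
  have Y': "(Y (Suc j) has_vector_derivative - (A j *v Y (Suc j) s) + f j (Y j s) + g s)
      (at s within {0..T})" if "s \<in> {0..T}" for s j
    using iteration[of j] that by (simp add: solves_ivp_def)
  have cont_y: "continuous_on {0..T} y"
    using y' by (rule continuous_on_vector_derivative)
  have cont_Y: "continuous_on {0..T} (Y j)" for j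
    using initial(1) continuous_on_vector_derivative[OF Y'] by (cases j) simp_all
  \<comment> \<open>Norm equivalence converts the Lipschitz bound in \<open>\<nu>\<close> into a
    Euclidean one. Continuity of \<open>f m\<close> makes the residual continuous, so that its
    maximum exists.\<close>
  have cont_f: "continuous_on S (f m)" for S
  proof -
    obtain c where c: "0 < c" "\<And>x. c * norm x \<le> ?q x"
    proof (rule real_norm.norm_le)
      show "x = 0" if "?q x = 0" for x
        using that norm by (simp add: vector_norm_def) (simp add: cvec_def vec_eq_iff)
    qed blast
    obtain K where K: "0 < K" "\<And>x. ?q x \<le> K * norm x" using real_norm.le_norm by blast
    have "norm (f m u - f m w) \<le> L * K / c * norm (u - w)" for u w
    proof -
      have "c * norm (f m u - f m w) \<le> L * ?q (u - w)" using c(2) lipschitz by (rule order_trans)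
      also have "\<dots> \<le> L * (K * norm (u - w))" by (intro mult_left_mono K L)
      finally show ?thesis using c(1) by (simp add: field_simps)
    qed
    then have "(L * K / c)-lipschitz_on S (f m)"
      using L K(1) c(1) by (intro lipschitz_onI) (auto simp: dist_norm)
    then show ?thesis by (rule lipschitz_on_continuous_on)
  qed
  \<comment> \<open>Inserting the equation of \<open>Y k\<close> cancels the linear part and
    \<open>g\<close>. No derivative remains, only the change of \<open>f m\<close> between
    consecutive iterates.\<close>
  have r_eq: "?r s = f m (Y k s) - f m (Y m s)" if "s \<in> {0..T}" for s
    using vector_derivative_within_closed_interval[OF T_pos that Y'[OF that]]
    by (simp add: wr_residual_def m)
  have "continuous_on {0..T} ?r \<longleftrightarrow> continuous_on {0..T} (\<lambda>s. f m (Y k s) - f m (Y m s))"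
    by (intro continuous_on_cong r_eq refl)
  then have cont_r: "continuous_on {0..T} ?r"
    by (auto intro!: continuous_intros continuous_on_compose2[OF cont_f[of UNIV] cont_Y])

  have sub: "{0..t} \<subseteq> {0..T}" using t by auto
  have cont: "continuous_on {0..t} (\<lambda>s. ?q (z s))" if "continuous_on {0..T} z" for z
    using continuous_on_compose2[OF real_norm.continuous[of UNIV] continuous_on_subset[OF that sub]]
    by simp
  have t_ne: "{0..t} \<noteq> {}" using t by simp
  obtain s0 where s0: "s0 \<in> {0..t}" "E = ?q (?e s0)"
    and E: "\<And>s. s \<in> {0..t} \<Longrightarrow> ?q (?e s) \<le> E"
    using max_on_attains[OF compact_Icc t_ne cont[of ?e]]
    by (auto simp: E_def intro: continuous_on_diff cont_y cont_Y)
  obtain s1 where s1: "s1 \<in> {0..t}" "R = ?q (?r s1)"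
    and R: "\<And>s. s \<in> {0..t} \<Longrightarrow> ?q (?r s) \<le> R"
    using max_on_attains[OF compact_Icc t_ne cont[OF cont_r]] by (auto simp: R_def)
  have nonneg: "0 \<le> E" "0 \<le> R" using s0(2) s1(2) real_norm.nonneg by auto

  have h_le: "?q (?h s) \<le> L * E + R" if "s \<in> {0..t}" for s
  proof -
    have "?q (?h s) \<le> L * ?q (?e s) + ?q (?r s)"
      using real_norm.triangle lipschitz by (rule order_trans[OF _ add_right_mono])
    also have "\<dots> \<le> L * E + R"
      using that by (intro add_mono mult_left_mono E R L)
    finally show ?thesis .
  qed
  have e': "(?e has_vector_derivative - (A m *v ?e s) + ?h s) (at s within {0..s0})"
    if "s \<in> {0..s0}" for s
  proof -
    have s: "s \<in> {0..T}" "{0..s0} \<subseteq> {0..T}" using that s0(1) t by auto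
    have "(?e has_vector_derivative - (A m *v y s) + f m (y s) + g s
        - (- (A m *v Y k s) + f m (Y m s) + g s)) (at s within {0..T})"
      unfolding m by (intro has_vector_derivative_diff y' Y' s)
    then have "(?e has_vector_derivative - (A m *v ?e s) + ?h s) (at s within {0..T})"
      by (simp add: r_eq[OF s(1)] matrix_vector_mult_diff_distrib algebra_simps)
    then show ?thesis using s(2) by (rule has_vector_derivative_within_subset)
  qed
  \<comment> \<open>The linear bound is used at the maximum point \<open>s0\<close> instead of
    \<open>t\<close>, so its left side is \<open>E\<close> itself; monotonicity of \<open>?P\<close>
    then replaces \<open>s0\<close> by \<open>t\<close>.\<close>
  have "E \<le> C * ?P s0 * (L * E + R)"
    unfolding s0(2)
  proof (rule linear_ivp_bound[OF norm exp_bound _ e'])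
    show "?e 0 = 0" using solution iteration[of m] by (simp add: solves_ivp_def m)
    show "?q (?h s) \<le> L * ?q (?e s0) + R" if "s \<in> {0..s0}" for s
      using h_le[of s] that s0 by auto
  qed (use s0(1) C_pos in auto)
  also have "\<dots> \<le> a * (L * E + R)"
    unfolding a_def using s0(1) C_pos L nonneg
    by (intro mult_right_mono mult_left_mono P_mono) auto
  finally have E_le: "(1 - L * a) * E \<le> a * R" by (simp add: algebra_simps)

  have a: "0 \<le> a" unfolding a_def using t C_pos P_nonneg by simp
  \<comment> \<open>Monotonicity up to \<open>T\<close> carries the convergence condition over to
    \<open>t\<close>. Hence \<open>1 - L * a\<close> is positive and \<open>E_le\<close> can be
    divided by it.\<close>
  have "L * a \<le> L * (C * ?P T)"
    unfolding a_def using t C_pos L by (intro mult_left_mono P_mono) auto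
  also have "\<dots> \<le> \<delta>" using convergence by (simp add: mult_ac)
  finally have La: "L * a \<le> \<delta>" .
  have factor: "C * t * phi1 (- \<omega> * t) / (1 - C * L * t * phi1 (- \<omega> * t)) = a / (1 - L * a)"
    by (simp add: a_def mult_ac)
  show "E \<le> C * t * phi1 (- \<omega> * t) / (1 - C * L * t * phi1 (- \<omega> * t)) * R"
    unfolding factor using E_le La delta(2) by (simp add: field_simps)

  \<comment> \<open>At \<open>L = 0\<close> the last constant would be 0, by the convention for
    division by zero.\<close>
  assume "L \<noteq> 0"
  with L have "0 < L" by simp
  \<comment> \<open>Cross-multiplying by the positive denominators reduces this to
    \<open>L * a \<le> \<delta>\<close>.\<close>
  have "a / (1 - L * a) \<le> \<delta> / ((1 - \<delta>) * L)"
    using \<open>0 < L\<close> La delta(2) by (simp add: frac_le_eq divide_le_0_iff) (simp add: algebra_simps)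
  then show "C * t * phi1 (- \<omega> * t) / (1 - C * L * t * phi1 (- \<omega> * t)) * R \<le> \<delta> / ((1 - \<delta>) * L) * R"
    unfolding factor using nonneg(2) by (rule mult_right_mono)
qed

end
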